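(* Let $\mathfrak{g}$ be an associative complex algebra with unit, and let $\mathcal{A}_k$ ($k\ge 0$) be the standard polynomials on $\mathfrak{g}$. Then for all $k,k'\ge 0$: $$[\mathcal{A}_{2k},\mathcal{A}_{2k'}]_a=0,\qquad [\mathcal{A}_{2k},\mathcal{A}_{2k'+1}]_a=(2k-1)\,\mathcal{A}_{2k+2k'},\qquad [\mathcal{A}_{2k+1},\mathcal{A}_{2k'+1}]_a=2(k-k')\,\mathcal{A}_{2k+2k'+1}.$$
   Context: $\mathcal{M}_a^0(\mathfrak{g})=\mathfrak{g}$ and, for $k\ge1$, $\mathcal{M}_a^k(\mathfrak{g})$ is the space of skew symmetric $k$-linear maps $\mathfrak{g}^k\to\mathfrak{g}$; $\mathcal{M}_a(\mathfrak{g})=\sum_{k\ge0}\mathcal{M}_a^k(\mathfrak{g})$. $\mathfrak{S}_{p,q}$ is the set of $(p,q)$-unshuffles: permutations $\sigma\in\mathfrak{S}_{p+q}$ with $\sigma(1)<\dots<\sigma(p)$ and $\sigma(p+1)<\dots<\sigma(p+q)$; $\varepsilon(\sigma)$ is the signature. Gerstenhaber(-Nijenhuis) bracket: for $F\in\mathcal{M}_a^{p+1}(\mathfrak{g})$, $G\in\mathcal{M}_a^{q+1}(\mathfrak{g})$ ($p,q\ge-1$), $[F,G]_a\in\mathcal{M}_a^{p+q+1}(\mathfrak{g})$ is $$[F,G]_a(X_1,\dots,X_{p+q+1})=(-1)^{pq}\sum_{\sigma\in\mathfrak{S}_{q+1,p}}\varepsilon(\sigma)F(G(X_{\sigma(1)},\dots,X_{\sigma(q+1)}),X_{\sigma(q+2)},\dots,X_{\sigma(p+q+1)})-\sum_{\sigma\in\mathfrak{S}_{p+1,q}}\varepsilon(\sigma)G(F(X_{\sigma(1)},\dots,X_{\sigma(p+1)}),X_{\sigma(p+2)},\dots,X_{\sigma(p+q+1)}).$$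 In particular for $X\in\mathfrak{g}=\mathcal{M}_a^0(\mathfrak{g})$, $[X,G]_a(X_1,\dots,X_q)=-G(X,X_1,\dots,X_q)$, and $[X,Y]_a=0$ for $X,Y\in\mathcal{M}_a^0(\mathfrak{g})$ (degree reasons). Standard polynomials: $\mathcal{A}_0=\mathbf{1}$ (the unit of $\mathfrak{g}$), and for $k\ge1$, $\mathcal{A}_k(Y_1,\dots,Y_k)=\sum_{\sigma\in\mathfrak{S}_k}\varepsilon(\sigma)\,Y_{\sigma(1)}\cdots Y_{\sigma(k)}$ (product in $\mathfrak{g}$). *)

theory Defs
  imports Complex_Main "HOL-Combinatorics.Permutations"
begin

(* The sort {ring, monoid_mult} is an associative unital ring in which 0 = 1 is not excluded. *)
locale complex_unital_algebra = vector_space scale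
  for scale :: "complex \<Rightarrow> 'a::{ring, monoid_mult} \<Rightarrow> 'a" +
  assumes mult_scale_left: "scale c x * y = scale c (x * y)"
    and mult_scale_right: "x * scale c y = scale c (x * y)"

(* A k-linear map is a function on lists of length k, with junk value 0 on lists of any other
   length, so that equality of such functions is equality of k-linear maps.  For k = 0 the map is
   determined by its value at [], which identifies the 0-ary maps with the algebra itself. *)
definition skew_multilinear_maps ::
    "(complex \<Rightarrow> 'a::{ring, monoid_mult} \<Rightarrow> 'a) \<Rightarrow> nat \<Rightarrow> ('a list \<Rightarrow> 'a) set" where
  "skew_multilinear_maps scale k =
    {F. (\<forall>xs. length xs \<noteq> k \<longrightarrow> F xs = 0) \<and>
        (\<forall>xs i. length xs = k \<and> i < k \<longrightarrow> Vector_Spaces.linear scale scale (\<lambda>x. F (xs[i := x]))) \<and>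
        (\<forall>xs \<sigma>. length xs = k \<and> \<sigma> permutes {..<k} \<longrightarrow>
          F (permute_list \<sigma> xs) = scale (of_int (sign \<sigma>)) (F xs))}"

(* Indices are 0-based. *)
definition unshuffles :: "nat \<Rightarrow> nat \<Rightarrow> (nat \<Rightarrow> nat) set" where
  "unshuffles r s = {\<sigma>. \<sigma> permutes {..<r + s} \<and>
    strict_mono_on {..<r} \<sigma> \<and> strict_mono_on {r..<r + s} \<sigma>}"

(* The sum over the (r,s)-unshuffles of eps(sigma) F(G(X_sigma(1),...,X_sigma(r)),
   X_sigma(r+1),...,X_sigma(r+s)), where G is r-ary and F is (s+1)-ary. *)
definition unshuffle_sum ::
    "(complex \<Rightarrow> 'a::{ring, monoid_mult} \<Rightarrow> 'a) \<Rightarrow> nat \<Rightarrow> nat \<Rightarrow>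
      ('a list \<Rightarrow> 'a) \<Rightarrow> ('a list \<Rightarrow> 'a) \<Rightarrow> 'a list \<Rightarrow> 'a" where
  "unshuffle_sum scale r s F G xs =
    (\<Sum>\<sigma>\<in>unshuffles r s. scale (of_int (sign \<sigma>))
      (F (G (take r (permute_list \<sigma> xs)) # drop r (permute_list \<sigma> xs))))"

(* F is m-ary and G is n-ary, i.e. p = m - 1 and q = n - 1, and the result is (m + n - 1)-ary.
   For m = 0 (resp. n = 0) the unshuffles in the first (resp. second) sum have a block of size -1,
   so that sum is empty.  For m = n = 0 the result lies in degree -1 and is 0, as no list
   satisfies the length condition. *)
definition gerstenhaber_bracket ::
    "(complex \<Rightarrow> 'a::{ring, monoid_mult} \<Rightarrow> 'a) \<Rightarrow> nat \<Rightarrow> nat \<Rightarrow>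
      ('a list \<Rightarrow> 'a) \<Rightarrow> ('a list \<Rightarrow> 'a) \<Rightarrow> 'a list \<Rightarrow> 'a" where
  "gerstenhaber_bracket scale m n F G xs =
    (if length xs + 1 = m + n then
       scale ((-1) powi ((int m - 1) * (int n - 1)))
         (if m = 0 then 0 else unshuffle_sum scale n (m - 1) F G xs)
       - (if n = 0 then 0 else unshuffle_sum scale m (n - 1) G F xs)
     else 0)"

definition standard_poly ::
    "(complex \<Rightarrow> 'a::{ring, monoid_mult} \<Rightarrow> 'a) \<Rightarrow> nat \<Rightarrow> 'a list \<Rightarrow> 'a" where
  "standard_poly scale k xs =
    (if length xs = k then
       \<Sum>\<sigma> | \<sigma> permutes {..<k}. scale (of_int (sign \<sigma>)) (prod_list (permute_list \<sigma> xs))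
     else 0)"

context complex_unital_algebra
begin

lemma standard_poly_0: "standard_poly scale 0 [] = 1"
  by (simp add: standard_poly_def sign_id)

lemma unshuffles_0_left: "unshuffles 0 s = {id}"
proof -
  have "\<sigma> = id" if p: "\<sigma> permutes {..<s}" and m: "strict_mono_on {0..<s} \<sigma>" for \<sigma>
  proof -
    have ge: "i < s \<Longrightarrow> i \<le> \<sigma> i" for i
    proof (induction i)
      case (Suc i)
      have "\<sigma> i < \<sigma> (Suc i)" using m Suc.prems by (intro strict_mono_onD[OF m]) auto
      then show ?case using Suc by simp
    qed simp
    show ?thesis
      by (rule permutes_natset_ge[OF p]) (use ge in auto)
  qed
  then show ?thesis
    by (auto simp: unshuffles_def permutes_id strict_mono_on_def)
qed

lemma bracket_0_left:
  assumes "length xs = q"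
  shows "gerstenhaber_bracket scale 0 (Suc q) F G xs = - G (F [] # xs)"
  using assms
  by (simp add: gerstenhaber_bracket_def unshuffle_sum_def unshuffles_0_left sign_id)

lemma bracket_0_0: "gerstenhaber_bracket scale 0 0 F G = (\<lambda>_. 0)"
  by (simp add: gerstenhaber_bracket_def fun_eq_iff)

lemma standard_poly_skew_multilinear:
  "standard_poly scale k \<in> skew_multilinear_maps scale k"
proof -
  have lin: "Vector_Spaces.linear scale scale (\<lambda>x. standard_poly scale k (xs[i := x]))"
    if len: "length xs = k" and i: "i < k" for xs i
  proof -
    have "\<exists>a b. \<forall>x. prod_list (permute_list \<sigma> (xs[i := x])) = a * x * b"
      if \<sigma>: "\<sigma> permutes {..<k}" for \<sigma>
    proof -
      define j where "j = inv \<sigma> i"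
      have j: "j < k" "\<sigma> j = i"
        using i permutes_in_image[OF permutes_inv[OF \<sigma>], of i] permutes_inverses(1)[OF \<sigma>]
        by (auto simp: j_def)
      have ne: "i \<noteq> \<sigma> l" if "l \<noteq> j" for l
        using that j(2) permutes_inj[OF \<sigma>] by (metis injD)
      have split: "[0..<k] = [0..<j] @ j # [Suc j..<k]"
        using j(1) by (metis append_Cons append_Nil le0 less_imp_le upt_add_eq_append upt_conv_Cons le_add_diff_inverse)
      have "permute_list \<sigma> (xs[i := x]) =
          map (\<lambda>l. xs ! \<sigma> l) [0..<j] @ x # map (\<lambda>l. xs ! \<sigma> l) [Suc j..<k]" for x
        using len i j(1) by (simp add: permute_list_def split j(2) nth_list_update ne)
      then have "prod_list (permute_list \<sigma> (xs[i := x])) =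
          prod_list (map (\<lambda>l. xs ! \<sigma> l) [0..<j]) * x * prod_list (map (\<lambda>l. xs ! \<sigma> l) [Suc j..<k])"
        for x by (simp add: mult.assoc)
      then show ?thesis by blast
    qed
    then obtain a b where ab: "\<And>\<sigma> x. \<sigma> permutes {..<k} \<Longrightarrow>
        prod_list (permute_list \<sigma> (xs[i := x])) = a \<sigma> * x * b \<sigma>"
      by metis
    have eq: "standard_poly scale k (xs[i := x]) =
        (\<Sum>\<sigma> | \<sigma> permutes {..<k}. scale (of_int (sign \<sigma>)) (a \<sigma> * x * b \<sigma>))" for x
      using len by (simp add: standard_poly_def ab)
    have vs: "vector_space scale" ..
    show ?thesis
      unfolding eq
      by (intro Vector_Spaces.linear.intro module_hom.intro module_hom_axioms.intro vs module_axioms)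
        (auto simp: distrib_left distrib_right scale_right_distrib sum.distrib
          mult_scale_left mult_scale_right scale_sum_right mult.commute)
  qed
  have skew: "standard_poly scale k (permute_list \<tau> xs) =
      scale (of_int (sign \<tau>)) (standard_poly scale k xs)"
    if len: "length xs = k" and \<tau>: "\<tau> permutes {..<k}" for xs \<tau>
  proof -
    have perm: "permutation \<sigma>" if "\<sigma> permutes {..<k}" for \<sigma>
      using that by (auto simp: permutation_permutes)
    have "standard_poly scale k (permute_list \<tau> xs) =
        (\<Sum>\<sigma> | \<sigma> permutes {..<k}. scale (of_int (sign \<sigma>)) (prod_list (permute_list (\<tau> \<circ> \<sigma>) xs)))"
      using len by (auto simp: standard_poly_def permute_list_compose intro!: sum.cong)
    also have "\<dots> = (\<Sum>\<sigma> | \<sigma> permutes {..<k}. scale (of_int (sign \<tau>))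
        (scale (of_int (sign (\<tau> \<circ> \<sigma>))) (prod_list (permute_list (\<tau> \<circ> \<sigma>) xs))))"
      by (rule sum.cong)
        (auto simp: sign_compose perm \<tau> mult.assoc[symmetric] simp flip: of_int_mult)
    also have "\<dots> = (\<Sum>\<sigma> | \<sigma> permutes {..<k}. scale (of_int (sign \<tau>))
        (scale (of_int (sign \<sigma>)) (prod_list (permute_list \<sigma> xs))))"
      by (rule setum_permutations_compose_left[OF \<tau>, symmetric])
    also have "\<dots> = scale (of_int (sign \<tau>)) (standard_poly scale k xs)"
      using len by (simp add: standard_poly_def scale_sum_right)
    finally show ?thesis .
  qed
  show ?thesis
    using lin skew by (auto simp: skew_multilinear_maps_def standard_poly_def)
qed

end

end

(* Every permutation of r + s letters is uniquely an (r, s)-unshuffle composed with a permutation of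
   the first r and one of the last s letters.  Expanding A_(s+1)(A_r(...), ...) according to the
   number j of letters in front of the inner A_r therefore yields, for each j, all words of r + s
   letters: inserting at position j costs the sign (-1)^j, and moving the block of r letters past j
   letters costs (-1)^(r j).  So the unshuffle sum is A_(r+s) times the sum over j <= s of
   (-1)^(j (r+1)), which is s + 1 for odd r and 1 or 0 for even r, according to the parity of s. *)
theory Submission
  imports Defs "HOL-Library.Infinite_Set"
begin

section \<open>Block permutations\<close>

text \<open>This embeds the product of the symmetric groups on r and on s letters into the one on r
  + s letters. No upper bound is tested: once \<tau> fixes every point from s on, the result fixes
  every point from r + s on.\<close>

definition block_perm :: "nat \<Rightarrow> (nat \<Rightarrow> nat) \<Rightarrow> (nat \<Rightarrow> nat) \<Rightarrow> nat \<Rightarrow> nat" where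
  "block_perm r \<alpha> \<tau> i = (if i < r then \<alpha> i else \<tau> (i - r) + r)"

lemma permutes_natset_less_iff:
  fixes p :: "nat \<Rightarrow> nat"
  assumes "p permutes {..<n}"
  shows "p i < n \<longleftrightarrow> i < n"
  using permutes_in_image[OF assms, of i] by simp

lemma permutes_natset_permutation:
  fixes p :: "nat \<Rightarrow> nat"
  assumes "p permutes {..<n}"
  shows "permutation p"
  using assms by (auto simp: permutation_permutes)

lemma sign_comp_permutes_natset:
  fixes p q :: "nat \<Rightarrow> nat"
  assumes "p permutes {..<n}" "q permutes {..<n}"
  shows "sign (p \<circ> q) = sign p * sign q"
  using assms permutes_natset_permutation by (intro sign_compose) blast+

text \<open>Seen as a transport of \<tau> along the shift by r, the second factor inherits its sign
  and the property of being a permutation from \<tau>.\<close>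

lemma block_perm_id_left:
  assumes "\<tau> permutes {..<s}"
  shows "block_perm r id \<tau> = map_permutation {..<s} (\<lambda>i. i + r) \<tau>"
proof
  fix i
  have inj: "inj_on (\<lambda>i. i + r) {..<s}" by (simp add: inj_on_def)
  consider "i < r" | l where "i = l + r" "l < s" | l where "i = l + r" "\<not> l < s"
    by (metis le_add_diff_inverse2 not_le)
  then show "block_perm r id \<tau> i = map_permutation {..<s} (\<lambda>i. i + r) \<tau> i"
  proof cases
    case 1
    then have "i \<notin> (\<lambda>i. i + r) ` {..<s}" by auto
    then show ?thesis using 1 by (simp add: block_perm_def map_permutation_def)
  next
    case 2
    then show ?thesis using map_permutation_apply[OF inj, of l \<tau>] by (simp add: block_perm_def)
  next
    case 3
    then have "i \<notin> (\<lambda>i. i + r) ` {..<s}" by auto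
    then show ?thesis using 3 permutes_not_in[OF assms, of l]
      by (simp add: block_perm_def map_permutation_def)
  qed
qed

text \<open>Since \<alpha> fixes all points from r on, the two factors act independently; signs and
  supports can then be computed for each factor alone.\<close>

lemma block_perm_eq_comp:
  assumes "\<alpha> permutes {..<r}"
  shows "block_perm r \<alpha> \<tau> = \<alpha> \<circ> block_perm r id \<tau>"
  using permutes_not_in[OF assms] by (auto simp: block_perm_def)

lemma block_perm_id_left_permutes:
  assumes "\<tau> permutes {..<s}"
  shows "block_perm r id \<tau> permutes {..<r + s}"
proof -
  have "bij_betw (\<lambda>i. i + r) {..<s} ((\<lambda>i. i + r) ` {..<s})"
    by (simp add: bij_betw_def inj_on_def)
  then have "block_perm r id \<tau> permutes (\<lambda>i. i + r) ` {..<s}"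
    unfolding block_perm_id_left[OF assms] using assms by (rule map_permutation_permutes)
  then show ?thesis by (rule permutes_subset) auto
qed

lemma block_perm_permutes:
  assumes "\<alpha> permutes {..<r}" "\<tau> permutes {..<s}"
  shows "block_perm r \<alpha> \<tau> permutes {..<r + s}"
  unfolding block_perm_eq_comp[OF assms(1)]
  by (rule permutes_compose[OF block_perm_id_left_permutes[OF assms(2)]])
    (rule permutes_subset[OF assms(1)], simp)

lemma sign_block_perm:
  assumes "\<alpha> permutes {..<r}" "\<tau> permutes {..<s}"
  shows "sign (block_perm r \<alpha> \<tau>) = sign \<alpha> * sign \<tau>"
proof -
  have "sign (block_perm r \<alpha> \<tau>) = sign \<alpha> * sign (block_perm r id \<tau>)"
    unfolding block_perm_eq_comp[OF assms(1)]
    using assms block_perm_id_left_permutes permutes_natset_permutation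
    by (intro sign_compose) blast+
  also have "sign (block_perm r id \<tau>) = sign \<tau>"
    unfolding block_perm_id_left[OF assms(2)]
    using assms(2) by (intro sign_map_permutation) (simp_all add: inj_on_def)
  finally show ?thesis .
qed

lemma permute_list_block_perm:
  assumes "\<alpha> permutes {..<length xs}" "\<tau> permutes {..<length ys}"
  shows "permute_list (block_perm (length xs) \<alpha> \<tau>) (xs @ ys) = permute_list \<alpha> xs @ permute_list \<tau> ys"
proof -
  have "block_perm (length xs) \<alpha> \<tau> permutes {..<length (xs @ ys)}"
    using block_perm_permutes[OF assms] by simp
  then show ?thesis
    using assms by (intro nth_equalityI)
      (auto simp: permute_list_nth block_perm_def nth_append permutes_natset_less_iff)
qed

text \<open>A permutation that preserves the first block also preserves its complement, so it
  restricts to both. This is used to recognize members of the block subgroup.\<close>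

lemma ex_block_perm:
  assumes p: "\<pi> permutes {..<r + s}" and img: "\<pi> ` {..<r} = {..<r}"
  obtains \<alpha> \<tau> where "\<alpha> permutes {..<r}" "\<tau> permutes {..<s}" "\<pi> = block_perm r \<alpha> \<tau>"
proof
  \<comment> \<open>The truncated subtraction in \<open>?\<tau>\<close> loses nothing, because \<pi>
    maps points from r on to points from r on.\<close>
  let ?\<alpha> = "\<lambda>i. if i < r then \<pi> i else i" and ?\<tau> = "\<lambda>i. \<pi> (i + r) - r"
  have inj: "inj \<pi>" using p by (rule permutes_inj)
  have lt: "\<pi> i < r \<longleftrightarrow> i < r" for i
    using img inj by (metis image_eqI inj_image_mem_iff lessThan_iff)
  have out: "\<pi> i = i" if "i \<ge> r + s" for i
    using permutes_not_in[OF p] that by simp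
  show "?\<alpha> permutes {..<r}"
    by (rule inj_imp_permutes) (use lt inj in \<open>auto simp: inj_on_def dest: injD\<close>)
  show "?\<tau> permutes {..<s}"
  proof (rule inj_imp_permutes)
    show "inj_on ?\<tau> {..<s}"
    proof (rule inj_onI)
      fix i l assume "?\<tau> i = ?\<tau> l"
      moreover have "\<pi> (i + r) \<ge> r" "\<pi> (l + r) \<ge> r" using lt by (simp_all add: leI)
      ultimately have "\<pi> (i + r) = \<pi> (l + r)" by linarith
      then show "i = l" using inj by (simp add: inj_eq)
    qed
    show "?\<tau> i \<in> {..<s}" if "i \<in> {..<s}" for i
      using permutes_natset_less_iff[OF p, of "i + r"] lt[of "i + r"] that by auto
  qed (use out in auto)
  show "\<pi> = block_perm r ?\<alpha> ?\<tau>"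
    using lt by (auto simp: block_perm_def fun_eq_iff leI)
qed

section \<open>Unshuffles as coset representatives\<close>

lemma strict_mono_on_permutes_eq_id:
  fixes p :: "nat \<Rightarrow> nat"
  assumes p: "p permutes {..<n}" and mono: "strict_mono_on {..<n} p"
  shows "p = id"
proof -
  have "i < n \<Longrightarrow> i \<le> p i" for i
  proof (induction i)
    case (Suc i)
    have "p i < p (Suc i)" using Suc.prems by (intro strict_mono_onD[OF mono]) auto
    then show ?case using Suc by simp
  qed simp
  then show ?thesis by (intro permutes_natset_ge[OF p]) auto
qed

lemma ex_sorting_permutation:
  fixes f :: "nat \<Rightarrow> nat"
  assumes "inj_on f {..<n}"
  obtains p where "p permutes {..<n}" "strict_mono_on {..<n} (f \<circ> p)"
proof -
  obtain h where h: "bij_betw h {..<n} (f ` {..<n})" "strict_mono_on {..<n} h"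
    using ex_bij_betw_strict_mono_card[of "f ` {..<n}"] card_image[OF assms] by auto
  have f: "bij_betw f {..<n} (f ` {..<n})" using assms by (simp add: bij_betw_def)
  \<comment> \<open>With h the increasing enumeration of the image of f, p is f inverse after h, so
    that f after p is h.\<close>
  define p where "p i = (if i < n then inv_into {..<n} f (h i) else i)" for i
  have "bij_betw (inv_into {..<n} f \<circ> h) {..<n} {..<n}"
    by (rule bij_betw_trans[OF h(1) bij_betw_inv_into[OF f]])
  then have "bij_betw p {..<n} {..<n}"
    by (rule bij_betw_cong[THEN iffD1, rotated]) (simp add: p_def)
  then have "p permutes {..<n}" by (rule bij_imp_permutes) (simp add: p_def)
  moreover have "(f \<circ> p) i = h i" if "i < n" for i
    using that h(1) bij_betw_inv_into_right[OF f] by (auto simp: p_def bij_betw_def)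
  then have "strict_mono_on {..<n} (f \<circ> p)"
    using h(2) by (simp add: strict_mono_on_def)
  ultimately show ?thesis using that by blast
qed

text \<open>Two unshuffles in the same left coset of the block subgroup differ by a block
  permutation g. Both increase on each block, so each component of g is increasing and hence the
  identity.\<close>

lemma unshuffles_comp_block_perm_inj:
  assumes \<sigma>: "\<sigma> \<in> unshuffles r s" and \<sigma>': "\<sigma>' \<in> unshuffles r s"
    and a: "\<alpha> permutes {..<r}" "\<alpha>' permutes {..<r}" and t: "\<tau> permutes {..<s}" "\<tau>' permutes {..<s}"
    and eq: "\<sigma> \<circ> block_perm r \<alpha> \<tau> = \<sigma>' \<circ> block_perm r \<alpha>' \<tau>'"
  shows "\<sigma> = \<sigma>' \<and> \<alpha> = \<alpha>' \<and> \<tau> = \<tau>'"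
proof -
  have p: "\<sigma> permutes {..<r + s}" "\<sigma>' permutes {..<r + s}"
    using \<sigma> \<sigma>' by (auto simp: unshuffles_def)
  define g where "g = inv \<sigma>' \<circ> \<sigma>"
  have gp: "g permutes {..<r + s}"
    unfolding g_def using p by (intro permutes_compose permutes_inv)
  have \<sigma>_eq: "\<sigma> = \<sigma>' \<circ> g"
    using permutes_inv_o(1)[OF p(2)] by (simp add: g_def o_assoc)
  have gb: "g \<circ> block_perm r \<alpha> \<tau> = block_perm r \<alpha>' \<tau>'"
    using eq permutes_inv_o(2)[OF p(2)] by (metis g_def o_assoc id_comp)
  \<comment> \<open>The first block is written as its own image under a block permutation, so that
    \<open>gb\<close> applies and shows that g preserves it.\<close>
  have "g ` {..<r} = g ` (block_perm r \<alpha> \<tau> ` {..<r})"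
    using permutes_image[OF a(1)] by (simp add: block_perm_def)
  also have "\<dots> = block_perm r \<alpha>' \<tau>' ` {..<r}"
    by (simp only: image_comp gb)
  also have "\<dots> = {..<r}"
    using permutes_image[OF a(2)] by (simp add: block_perm_def)
  finally obtain \<beta> \<upsilon> where b: "\<beta> permutes {..<r}" "\<upsilon> permutes {..<s}" "g = block_perm r \<beta> \<upsilon>"
    using ex_block_perm[OF gp] by metis
  have m: "strict_mono_on {..<r} \<sigma>" "strict_mono_on {r..<r + s} \<sigma>"
    "strict_mono_on {..<r} \<sigma>'" "strict_mono_on {r..<r + s} \<sigma>'"
    using \<sigma> \<sigma>' by (auto simp: unshuffles_def)
  \<comment> \<open>On the first block \<sigma> is \<sigma>' after \<beta>. Both unshuffles increase
    there, and \<sigma>' reflects the order, so \<beta> increases. The second block is treated alike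
    after the shift by r.\<close>
  have "strict_mono_on {..<r} \<beta>"
  proof (rule strict_mono_onI)
    fix i l assume il: "i \<in> {..<r}" "l \<in> {..<r}" "i < l"
    then have "\<sigma>' (\<beta> i) < \<sigma>' (\<beta> l)"
      using strict_mono_onD[OF m(1), of i l] by (simp add: \<sigma>_eq b(3) block_perm_def)
    then show "\<beta> i < \<beta> l"
      using il permutes_natset_less_iff[OF b(1)] by (simp add: strict_mono_on_less[OF m(3)])
  qed
  then have "\<beta> = id" using b(1) strict_mono_on_permutes_eq_id by blast
  have "strict_mono_on {..<s} \<upsilon>"
  proof (rule strict_mono_onI)
    fix i l assume il: "i \<in> {..<s}" "l \<in> {..<s}" "i < l"
    then have "\<sigma>' (\<upsilon> i + r) < \<sigma>' (\<upsilon> l + r)"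
      using strict_mono_onD[OF m(2), of "i + r" "l + r"] by (simp add: \<sigma>_eq b(3) block_perm_def)
    then show "\<upsilon> i < \<upsilon> l"
      using il permutes_natset_less_iff[OF b(2)] by (simp add: strict_mono_on_less[OF m(4)])
  qed
  then have "\<upsilon> = id" using b(2) strict_mono_on_permutes_eq_id by blast
  have "g = id" using \<open>\<beta> = id\<close> \<open>\<upsilon> = id\<close> by (auto simp: b(3) block_perm_def)
  then have bb: "block_perm r \<alpha> \<tau> i = block_perm r \<alpha>' \<tau>' i" for i using gb by simp
  have "\<alpha> i = \<alpha>' i" for i
    using bb[of i] permutes_not_in[OF a(1), of i] permutes_not_in[OF a(2), of i]
    by (cases "i < r") (simp_all add: block_perm_def)
  moreover have "\<tau> i = \<tau>' i" for i
    using bb[of "i + r"] by (simp add: block_perm_def)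
  ultimately show ?thesis using \<open>g = id\<close> \<sigma>_eq by auto
qed

text \<open>Every left coset of the block subgroup contains exactly one unshuffle; it is found by
  sorting the values of \<pi> within each block.\<close>

lemma bij_betw_unshuffles_comp_block_perm:
  "bij_betw (\<lambda>(\<sigma>, \<alpha>, \<tau>). \<sigma> \<circ> block_perm r \<alpha> \<tau>)
     (unshuffles r s \<times> {\<alpha>. \<alpha> permutes {..<r}} \<times> {\<tau>. \<tau> permutes {..<s}})
     {\<pi>. \<pi> permutes {..<r + s}}"
proof (rule bij_betw_imageI)
  show "inj_on (\<lambda>(\<sigma>, \<alpha>, \<tau>). \<sigma> \<circ> block_perm r \<alpha> \<tau>)
      (unshuffles r s \<times> {\<alpha>. \<alpha> permutes {..<r}} \<times> {\<tau>. \<tau> permutes {..<s}})"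
    by (rule inj_onI) (clarsimp, rule unshuffles_comp_block_perm_inj, assumption+)
  have "\<pi> \<in> (\<lambda>(\<sigma>, \<alpha>, \<tau>). \<sigma> \<circ> block_perm r \<alpha> \<tau>) `
      (unshuffles r s \<times> {\<alpha>. \<alpha> permutes {..<r}} \<times> {\<tau>. \<tau> permutes {..<s}})"
    if \<pi>: "\<pi> permutes {..<r + s}" for \<pi>
  proof -
    have inj: "inj \<pi>" using \<pi> by (rule permutes_inj)
    obtain \<alpha> where \<alpha>: "\<alpha> permutes {..<r}" "strict_mono_on {..<r} (\<pi> \<circ> \<alpha>)"
      using ex_sorting_permutation[of \<pi> r] inj by (metis inj_on_subset subset_UNIV)
    have "inj_on (\<lambda>i. \<pi> (i + r)) {..<s}" using inj by (intro inj_onI) (simp add: inj_eq)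
    then obtain \<tau> where \<tau>: "\<tau> permutes {..<s}" "strict_mono_on {..<s} ((\<lambda>i. \<pi> (i + r)) \<circ> \<tau>)"
      by (rule ex_sorting_permutation)
    \<comment> \<open>This is the sorted representative of the coset of \<pi>; the inverses of the
      two sorting permutations lead back to \<pi>.\<close>
    define \<sigma> where "\<sigma> = \<pi> \<circ> block_perm r \<alpha> \<tau>"
    have "strict_mono_on {..<r} \<sigma>"
      using \<alpha>(2) by (auto simp: \<sigma>_def block_perm_def strict_mono_on_def)
    moreover have "strict_mono_on {r..<r + s} \<sigma>"
    proof (rule strict_mono_onI)
      fix i l assume "i \<in> {r..<r + s}" "l \<in> {r..<r + s}" "i < l"
      then show "\<sigma> i < \<sigma> l"
        using strict_mono_onD[OF \<tau>(2), of "i - r" "l - r"]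
        by (auto simp: \<sigma>_def block_perm_def diff_less_mono)
    qed
    ultimately have "\<sigma> \<in> unshuffles r s"
      using permutes_compose[OF block_perm_permutes[OF \<alpha>(1) \<tau>(1)] \<pi>]
      by (simp add: unshuffles_def \<sigma>_def)
    moreover have "block_perm r \<alpha> \<tau> \<circ> block_perm r (inv \<alpha>) (inv \<tau>) = id"
      using permutes_inverses[OF \<alpha>(1)] permutes_inverses[OF \<tau>(1)]
        permutes_natset_less_iff[OF permutes_inv[OF \<alpha>(1)]]
      by (auto simp: block_perm_def)
    then have "\<pi> = \<sigma> \<circ> block_perm r (inv \<alpha>) (inv \<tau>)"
      by (simp add: \<sigma>_def comp_assoc)
    ultimately show ?thesis
      using permutes_inv[OF \<alpha>(1)] permutes_inv[OF \<tau>(1)] by force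
  qed
  then show "(\<lambda>(\<sigma>, \<alpha>, \<tau>). \<sigma> \<circ> block_perm r \<alpha> \<tau>) `
      (unshuffles r s \<times> {\<alpha>. \<alpha> permutes {..<r}} \<times> {\<tau>. \<tau> permutes {..<s}})
      = {\<pi>. \<pi> permutes {..<r + s}}"
    by (auto simp: unshuffles_def intro!: permutes_compose block_perm_permutes)
qed

section \<open>Cycles and moving blocks of letters\<close>

text \<open>A cycle on the j + 1 points up to j. Permuting a list by it moves the head to position j
  and the j letters behind it one place forward.\<close>

definition front_cycle :: "nat \<Rightarrow> nat \<Rightarrow> nat" where
  "front_cycle j i = (if i < j then Suc i else if i = j then 0 else i)"

lemma front_cycle_0: "front_cycle 0 = id"
  by (auto simp: front_cycle_def)

text \<open>Splitting off one adjacent transposition is what drives the inductions for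
  \<open>permutes\<close> and for the sign.\<close>

lemma front_cycle_Suc: "front_cycle (Suc j) = front_cycle j \<circ> transpose j (Suc j)"
  by (auto simp: front_cycle_def fun_eq_iff transpose_def)

lemma front_cycle_permutes:
  assumes "j < n"
  shows "front_cycle j permutes {..<n}"
  using assms
proof (induction j)
  case (Suc j)
  then show ?case
    unfolding front_cycle_Suc by (intro permutes_compose permutes_swap_id) auto
qed (simp add: front_cycle_0)

lemma sign_front_cycle: "sign (front_cycle j) = (-1) ^ j"
proof (induction j)
  case (Suc j)
  have "permutation (front_cycle j)"
    using front_cycle_permutes[OF lessI] by (rule permutes_natset_permutation)
  then have "sign (front_cycle (Suc j)) = sign (front_cycle j) * sign (transpose j (Suc j))"
    unfolding front_cycle_Suc by (intro sign_compose permutation_swap_id)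
  then show ?case using Suc by (simp add: sign_swap_id)
qed (simp add: front_cycle_0)

lemma permute_list_front_cycle:
  assumes "m < length ys"
  shows "permute_list (front_cycle m) ys = rotate1 (take (Suc m) ys) @ drop (Suc m) ys"
proof (rule nth_equalityI)
  fix i assume "i < length (permute_list (front_cycle m) ys)"
  then have i: "i < length ys" by simp
  \<comment> \<open>For i \<le> m, \<open>rotate1\<close> reads index i + 1 modulo m + 1, which
    wraps to 0 exactly at i = m, as \<open>front_cycle\<close> does.\<close>
  show "permute_list (front_cycle m) ys ! i = (rotate1 (take (Suc m) ys) @ drop (Suc m) ys) ! i"
    using assms i
    by (simp add: permute_list_nth[OF front_cycle_permutes] nth_append nth_rotate1 front_cycle_def
        mod_Suc min_def)
qed (use assms in simp)

text \<open>The claims share one induction, since the sign step needs the previous power to be a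
  permutation.\<close>

lemma permute_list_front_cycle_pow:
  assumes "m < length ys"
  shows "(front_cycle m ^^ t) permutes {..<length ys}
    \<and> sign (front_cycle m ^^ t) = (-1) ^ (t * m)
    \<and> permute_list (front_cycle m ^^ t) ys = rotate t (take (Suc m) ys) @ drop (Suc m) ys"
proof (induction t)
  case (Suc t)
  have c: "front_cycle m permutes {..<length ys}" using assms by (rule front_cycle_permutes)
  have eq: "front_cycle m ^^ Suc t = (front_cycle m ^^ t) \<circ> front_cycle m"
    by (simp only: funpow_Suc_right)
  have "sign (front_cycle m ^^ Suc t) = (-1) ^ (Suc t * m)"
    unfolding eq using Suc sign_comp_permutes_natset[OF _ c, of "front_cycle m ^^ t"]
    by (simp add: sign_front_cycle power_add mult.commute)
  moreover have "permute_list (front_cycle m ^^ Suc t) ys =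
      rotate (Suc t) (take (Suc m) ys) @ drop (Suc m) ys"
    unfolding eq permute_list_compose[OF c] using Suc assms
    by (simp add: permute_list_front_cycle)
  ultimately show ?case
    using permutes_compose[OF c, of "front_cycle m ^^ t"] Suc unfolding eq by blast
qed (simp add: permutes_id[unfolded id_def])

text \<open>Rotating the first r + j letters r times carries the leading block of r letters past the
  next j.\<close>

lemma ex_block_swap:
  assumes "r + j \<le> n"
  obtains \<kappa> where "\<kappa> permutes {..<n}" "sign \<kappa> = (-1) ^ (r * j)"
    "\<And>ys :: 'a list. length ys = n \<Longrightarrow>
      permute_list \<kappa> ys = take j (drop r ys) @ take r ys @ drop (r + j) ys"
proof (cases "r + j")
  case 0
  then show ?thesis using that[of id] by simp
next
  case (Suc m)
  let ?\<kappa> = "front_cycle m ^^ r"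
  have *: "m < length ys" if "length ys = n" for ys :: "'b list" using that Suc assms by simp
  \<comment> \<open>Here m = r + j - 1, so r m and r j differ by r (r - 1), which is even.\<close>
  have "even (r * m) \<longleftrightarrow> even (r * j)"
    using Suc by (metis even_Suc even_add even_mult_iff)
  then have "(-1 :: int) ^ (r * m) = (-1) ^ (r * j)" by (simp add: minus_one_power_iff)
  then have "?\<kappa> permutes {..<n}" "sign ?\<kappa> = (-1) ^ (r * j)"
    \<comment> \<open>These two facts see the list only through its length, so a dummy list of
      length n provides them.\<close>
    using permute_list_front_cycle_pow[OF *[of "replicate n ()"], of r] by simp_all
  moreover have "permute_list ?\<kappa> ys = take j (drop r ys) @ take r ys @ drop (r + j) ys"
    if "length ys = n" for ys :: "'a list"
  proof -
    have "length (take r ys) = r" using that assms by simp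
    then have "rotate r (take (r + j) ys) = take j (drop r ys) @ take r ys"
      by (metis rotate_append take_add)
    then show ?thesis
      using permute_list_front_cycle_pow[OF *[OF that], of r] Suc by simp
  qed
  ultimately show ?thesis using that by blast
qed

text \<open>A permutation of s + 1 letters is determined by the position j of letter 0 together with
  the arrangement \<tau> of the other s letters.\<close>

lemma bij_betw_block_perm_front_cycle:
  "bij_betw (\<lambda>(j, \<tau>). block_perm 1 id \<tau> \<circ> front_cycle j)
     ({..s} \<times> {\<tau>. \<tau> permutes {..<s}}) {\<rho>. \<rho> permutes {..<Suc s}}"
proof (rule bij_betw_imageI)
  have perm: "(block_perm 1 id \<tau> \<circ> front_cycle j) permutes {..<Suc s}"
    if "j \<le> s" "\<tau> permutes {..<s}" for j \<tau>
    using block_perm_permutes[of id 1 \<tau> s] front_cycle_permutes[of j "Suc s"] that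
    by (intro permutes_compose) simp_all
  have zero: "(block_perm 1 id \<tau> \<circ> front_cycle j) i = 0 \<longleftrightarrow> i = j" for i j \<tau>
    by (auto simp: block_perm_def front_cycle_def)
  show "inj_on (\<lambda>(j, \<tau>). block_perm 1 id \<tau> \<circ> front_cycle j) ({..s} \<times> {\<tau>. \<tau> permutes {..<s}})"
  proof (rule inj_onI, clarify)
    fix j j' \<tau> \<tau>'
    assume eq: "block_perm 1 id \<tau> \<circ> front_cycle j = block_perm 1 id \<tau>' \<circ> front_cycle j'"
    then have j: "j = j'" using zero by metis
    have "\<tau> i = \<tau>' i" for i
    proof -
      obtain l where "front_cycle j l = Suc i"
        using permutes_surj[OF front_cycle_permutes[of j "Suc j"]] by (metis lessI surjD)
      then show ?thesis using fun_cong[OF eq, of l] j by (simp add: block_perm_def)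
    qed
    then show "j = j' \<and> \<tau> = \<tau>'" using j by auto
  qed
  have "\<rho> \<in> (\<lambda>(j, \<tau>). block_perm 1 id \<tau> \<circ> front_cycle j) ` ({..s} \<times> {\<tau>. \<tau> permutes {..<s}})"
    if \<rho>: "\<rho> permutes {..<Suc s}" for \<rho>
  proof -
    define j where "j = inv \<rho> 0"
    have j: "\<rho> j = 0" "j < Suc s"
      using permutes_inverses[OF \<rho>] permutes_natset_less_iff[OF permutes_inv[OF \<rho>], of 0]
      by (auto simp: j_def)
    have c: "front_cycle j permutes {..<Suc s}" using j(2) by (rule front_cycle_permutes)
    \<comment> \<open>Cancelling the cycle that moves letter 0 to position j leaves a permutation
      fixing 0, which splits with a trivial first factor.\<close>
    define q where "q = \<rho> \<circ> inv (front_cycle j)"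
    have q: "q permutes {..<1 + s}"
      unfolding q_def using permutes_compose[OF permutes_inv[OF c] \<rho>] by simp
    have "front_cycle j j = 0" by (simp add: front_cycle_def)
    then have "inv (front_cycle j) 0 = j" using permutes_inverses(2)[OF c] by metis
    then have "q ` {..<1} = {..<1}" using j by (simp add: q_def lessThan_Suc)
    then obtain \<alpha> \<tau> where at: "\<alpha> permutes {..<1}" "\<tau> permutes {..<s}" "q = block_perm 1 \<alpha> \<tau>"
      using ex_block_perm[OF q] by metis
    have "\<alpha> = id" using at(1) by (simp add: lessThan_Suc permutes_sing)
    moreover have "\<rho> = q \<circ> front_cycle j"
      using permutes_inv_o(2)[OF c] by (simp add: q_def comp_assoc)
    ultimately show ?thesis using at j(2) by force
  qed
  then show "(\<lambda>(j, \<tau>). block_perm 1 id \<tau> \<circ> front_cycle j) ` ({..s} \<times> {\<tau>. \<tau> permutes {..<s}})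
      = {\<rho>. \<rho> permutes {..<Suc s}}"
    using perm by auto
qed

section \<open>Nested standard polynomials\<close>

context complex_unital_algebra
begin

text \<open>The permutations are sorted by the position j at which y lands; the cycle inserting y
  there contributes the sign (-1)^j.\<close>

lemma standard_poly_Cons:
  assumes len: "length zs = s"
  shows "standard_poly scale (Suc s) (y # zs) =
    (\<Sum>j\<le>s. \<Sum>\<tau> | \<tau> permutes {..<s}. scale (of_int ((-1) ^ j * sign \<tau>))
      (prod_list (take j (permute_list \<tau> zs)) * y * prod_list (drop j (permute_list \<tau> zs))))"
proof -
  have summand: "scale (of_int (sign (block_perm 1 id \<tau> \<circ> front_cycle j)))
        (prod_list (permute_list (block_perm 1 id \<tau> \<circ> front_cycle j) (y # zs))) =
      scale (of_int ((-1) ^ j * sign \<tau>))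
        (prod_list (take j (permute_list \<tau> zs)) * y * prod_list (drop j (permute_list \<tau> zs)))"
    if j: "j \<le> s" and \<tau>: "\<tau> permutes {..<s}" for j \<tau>
  proof -
    have c: "front_cycle j permutes {..<Suc s}" using j by (intro front_cycle_permutes) simp
    have b: "block_perm 1 id \<tau> permutes {..<Suc s}"
      using block_perm_permutes[of id 1 \<tau> s] \<tau> by simp
    have "sign (block_perm 1 id \<tau> \<circ> front_cycle j) = (-1) ^ j * sign \<tau>"
      using sign_comp_permutes_natset[OF b c] sign_block_perm[of id 1 \<tau> s] \<tau>
      by (simp add: sign_front_cycle)
    moreover have "permute_list (block_perm 1 id \<tau>) (y # zs) = y # permute_list \<tau> zs"
      using permute_list_block_perm[of id "[y]" \<tau> zs] \<tau> len by simp
    then have "permute_list (block_perm 1 id \<tau> \<circ> front_cycle j) (y # zs) =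
        take j (permute_list \<tau> zs) @ y # drop j (permute_list \<tau> zs)"
      using c j len by (simp add: permute_list_compose permute_list_front_cycle)
    ultimately show ?thesis by (simp add: mult.assoc)
  qed
  have "standard_poly scale (Suc s) (y # zs) =
      (\<Sum>\<rho> | \<rho> permutes {..<Suc s}. scale (of_int (sign \<rho>)) (prod_list (permute_list \<rho> (y # zs))))"
    using len by (simp add: standard_poly_def)
  also have "\<dots> = (\<Sum>(j, \<tau>) \<in> {..s} \<times> {\<tau>. \<tau> permutes {..<s}}.
      scale (of_int (sign (block_perm 1 id \<tau> \<circ> front_cycle j)))
        (prod_list (permute_list (block_perm 1 id \<tau> \<circ> front_cycle j) (y # zs))))"
    by (subst sum.reindex_bij_betw[OF bij_betw_block_perm_front_cycle, symmetric])
      (simp add: case_prod_unfold)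
  also have "\<dots> = (\<Sum>(j, \<tau>) \<in> {..s} \<times> {\<tau>. \<tau> permutes {..<s}}. scale (of_int ((-1) ^ j * sign \<tau>))
      (prod_list (take j (permute_list \<tau> zs)) * y * prod_list (drop j (permute_list \<tau> zs))))"
    using summand by (intro sum.cong) auto
  finally show ?thesis by (simp add: sum.cartesian_product)
qed

text \<open>The inner polynomial is expanded in place of y. Writing \<alpha> and \<tau> as one
  permutation of the whole list prepares the merger with the unshuffles.\<close>

lemma standard_poly_standard_poly:
  assumes len: "length ys = r + s"
  shows "standard_poly scale (Suc s) (standard_poly scale r (take r ys) # drop r ys) =
    (\<Sum>j\<le>s. \<Sum>\<alpha> | \<alpha> permutes {..<r}. \<Sum>\<tau> | \<tau> permutes {..<s}.
      scale (of_int ((-1) ^ j * sign (block_perm r \<alpha> \<tau>)))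
        (let zs = permute_list (block_perm r \<alpha> \<tau>) ys
         in prod_list (take j (drop r zs) @ take r zs @ drop (r + j) zs)))"
proof -
  have summand: "scale (of_int ((-1) ^ j * sign \<tau>))
      (prod_list (take j (permute_list \<tau> (drop r ys))) * standard_poly scale r (take r ys) *
       prod_list (drop j (permute_list \<tau> (drop r ys)))) =
    (\<Sum>\<alpha> | \<alpha> permutes {..<r}. scale (of_int ((-1) ^ j * sign (block_perm r \<alpha> \<tau>)))
        (let zs = permute_list (block_perm r \<alpha> \<tau>) ys
         in prod_list (take j (drop r zs) @ take r zs @ drop (r + j) zs)))"
    if \<tau>: "\<tau> permutes {..<s}" for j \<tau>
  proof -
    have "scale (of_int ((-1) ^ j * sign \<tau>))
        (prod_list (take j (permute_list \<tau> (drop r ys))) * 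
          scale (of_int (sign \<alpha>)) (prod_list (permute_list \<alpha> (take r ys))) *
         prod_list (drop j (permute_list \<tau> (drop r ys)))) =
      scale (of_int ((-1) ^ j * sign (block_perm r \<alpha> \<tau>)))
        (let zs = permute_list (block_perm r \<alpha> \<tau>) ys
         in prod_list (take j (drop r zs) @ take r zs @ drop (r + j) zs))"
      if \<alpha>: "\<alpha> permutes {..<r}" for \<alpha>
    proof -
      have "permute_list (block_perm r \<alpha> \<tau>) ys =
          permute_list \<alpha> (take r ys) @ permute_list \<tau> (drop r ys)"
        using permute_list_block_perm[of \<alpha> "take r ys" \<tau> "drop r ys"] \<alpha> \<tau> len by simp
      then show ?thesis
        using len by (simp add: Let_def sign_block_perm[OF \<alpha> \<tau>] mult_scale_left mult_scale_right
            mult.assoc mult.left_commute mult.commute[of _ "of_int (sign \<alpha>)"])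
    qed
    then show ?thesis
      using len by (simp add: standard_poly_def scale_sum_right sum_distrib_left sum_distrib_right)
  qed
  have "length (drop r ys) = s" using len by simp
  then show ?thesis
    \<comment> \<open>The right-hand side is put in the order j, \<tau>, \<alpha>, where the sum
      over \<alpha> matches a single summand of \<open>standard_poly_Cons\<close>.\<close>
    by (simp only: standard_poly_Cons sum.swap[of _ "{\<tau>. \<tau> permutes {..<s}}" "{\<alpha>. \<alpha> permutes {..<r}}"])
      (intro sum.cong refl, simp only: mem_Collect_eq summand)
qed

text \<open>Both terms of the bracket have this form, so a single evaluation serves for both; the
  parity of r and s is left for later.\<close>

lemma unshuffle_sum_standard_poly:
  assumes len: "length xs = r + s"
  shows "unshuffle_sum scale r s (standard_poly scale (Suc s)) (standard_poly scale r) xs =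
    scale (\<Sum>j\<le>s. (-1) ^ (j * Suc r)) (standard_poly scale (r + s) xs)"
proof -
  define w where "w j zs = prod_list (take j (drop r zs) @ take r zs @ drop (r + j) zs)"
    for j and zs :: "'a list"
  let ?S = "\<lambda>n. {\<pi>. \<pi> permutes {..<n::nat}}"
  have "unshuffle_sum scale r s (standard_poly scale (Suc s)) (standard_poly scale r) xs =
      (\<Sum>\<sigma>\<in>unshuffles r s. \<Sum>j\<le>s. \<Sum>\<alpha>\<in>?S r. \<Sum>\<tau>\<in>?S s. scale ((-1) ^ j)
        (scale (of_int (sign (\<sigma> \<circ> block_perm r \<alpha> \<tau>)))
          (w j (permute_list (\<sigma> \<circ> block_perm r \<alpha> \<tau>) xs))))"
    unfolding unshuffle_sum_def
  proof (rule sum.cong[OF refl])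
    fix \<sigma> assume "\<sigma> \<in> unshuffles r s"
    then have \<sigma>: "\<sigma> permutes {..<r + s}" by (simp add: unshuffles_def)
    have "scale (of_int (sign \<sigma>)) (scale (of_int ((-1) ^ j * sign (block_perm r \<alpha> \<tau>)))
          (w j (permute_list (block_perm r \<alpha> \<tau>) (permute_list \<sigma> xs)))) =
        scale ((-1) ^ j) (scale (of_int (sign (\<sigma> \<circ> block_perm r \<alpha> \<tau>)))
          (w j (permute_list (\<sigma> \<circ> block_perm r \<alpha> \<tau>) xs)))"
      if "\<alpha> \<in> ?S r" "\<tau> \<in> ?S s" for j \<alpha> \<tau>
      using that block_perm_permutes[of \<alpha> r \<tau> s] \<sigma> len
      by (simp add: permute_list_compose sign_comp_permutes_natset mult_ac)
    then have "(\<Sum>j\<le>s. \<Sum>\<alpha>\<in>?S r. \<Sum>\<tau>\<in>?S s.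
          scale (of_int (sign \<sigma>)) (scale (of_int ((-1) ^ j * sign (block_perm r \<alpha> \<tau>)))
          (w j (permute_list (block_perm r \<alpha> \<tau>) (permute_list \<sigma> xs))))) =
        (\<Sum>j\<le>s. \<Sum>\<alpha>\<in>?S r. \<Sum>\<tau>\<in>?S s. scale ((-1) ^ j)
          (scale (of_int (sign (\<sigma> \<circ> block_perm r \<alpha> \<tau>)))
          (w j (permute_list (\<sigma> \<circ> block_perm r \<alpha> \<tau>) xs))))"
      by (intro sum.cong refl)
    moreover have "length (permute_list \<sigma> xs) = r + s" using len by simp
    ultimately show "scale (of_int (sign \<sigma>)) (standard_poly scale (Suc s)
          (standard_poly scale r (take r (permute_list \<sigma> xs)) # drop r (permute_list \<sigma> xs))) =
        (\<Sum>j\<le>s. \<Sum>\<alpha>\<in>?S r. \<Sum>\<tau>\<in>?S s. scale ((-1) ^ j)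
          (scale (of_int (sign (\<sigma> \<circ> block_perm r \<alpha> \<tau>)))
          (w j (permute_list (\<sigma> \<circ> block_perm r \<alpha> \<tau>) xs))))"
      by (simp only: standard_poly_standard_poly Let_def scale_sum_right flip: w_def)
  qed
  \<comment> \<open>With j outermost, the remaining triples run over each permutation of r + s
    letters exactly once.\<close>
  also have "\<dots> = (\<Sum>j\<le>s. scale ((-1) ^ j) (\<Sum>(\<sigma>, \<alpha>, \<tau>) \<in> unshuffles r s \<times> ?S r \<times> ?S s.
      scale (of_int (sign (\<sigma> \<circ> block_perm r \<alpha> \<tau>)))
          (w j (permute_list (\<sigma> \<circ> block_perm r \<alpha> \<tau>) xs))))"
    by (subst sum.swap) (simp only: sum.cartesian_product scale_sum_right
        case_prod_unfold)
  also have "\<dots> = (\<Sum>j\<le>s. scale ((-1) ^ j) (\<Sum>\<pi>\<in>?S (r + s).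
      scale (of_int (sign \<pi>)) (w j (permute_list \<pi> xs))))"
    by (subst sum.reindex_bij_betw[OF bij_betw_unshuffles_comp_block_perm, symmetric])
      (simp add: case_prod_unfold)
  also have "\<dots> = (\<Sum>j\<le>s. scale ((-1) ^ (j * Suc r)) (standard_poly scale (r + s) xs))"
  proof (rule sum.cong[OF refl])
    \<comment> \<open>For fixed j the word is the product of the list permuted by \<pi> \<circ>
      \<kappa>, with \<kappa> the block swap. Since \<kappa> has sign 1 or -1, the sign of \<pi> is
      the product of those of \<kappa> and \<pi> \<circ> \<kappa>.\<close>
    fix j assume "j \<in> {..s}"
    then obtain \<kappa> where \<kappa>: "\<kappa> permutes {..<r + s}" "sign \<kappa> = (-1) ^ (r * j)"
      "\<And>ys :: 'a list. length ys = r + s \<Longrightarrow>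
        permute_list \<kappa> ys = take j (drop r ys) @ take r ys @ drop (r + j) ys"
      using ex_block_swap[of r j "r + s"] by auto
    have "(\<Sum>\<pi>\<in>?S (r + s). scale (of_int (sign \<pi>)) (w j (permute_list \<pi> xs))) =
        (\<Sum>\<pi>\<in>?S (r + s). scale (of_int (sign \<kappa>)) (scale (of_int (sign (\<pi> \<circ> \<kappa>)))
          (prod_list (permute_list (\<pi> \<circ> \<kappa>) xs))))"
    proof (rule sum.cong[OF refl])
      fix \<pi> assume "\<pi> \<in> ?S (r + s)"
      then have "sign (\<pi> \<circ> \<kappa>) = sign \<kappa> * sign \<pi>"
        "permute_list (\<pi> \<circ> \<kappa>) xs = permute_list \<kappa> (permute_list \<pi> xs)"
        using \<kappa>(1) len
        by (simp_all add: permute_list_compose sign_comp_permutes_natset)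
      then show "scale (of_int (sign \<pi>)) (w j (permute_list \<pi> xs)) =
          scale (of_int (sign \<kappa>)) (scale (of_int (sign (\<pi> \<circ> \<kappa>)))
          (prod_list (permute_list (\<pi> \<circ> \<kappa>) xs)))"
        using len by (simp add: \<kappa>(3) w_def flip: of_int_mult)
    qed
    \<comment> \<open>Right translation by \<kappa> only permutes the summands.\<close>
    also have "\<dots> = scale (of_int (sign \<kappa>)) (standard_poly scale (r + s) xs)"
      using len sum_permutations_compose_right[OF \<kappa>(1),
          of "\<lambda>\<pi>. scale (of_int (sign \<pi>)) (prod_list (permute_list \<pi> xs))"]
      by (simp add: standard_poly_def flip: scale_sum_right del: scale_scale)
    finally show "scale ((-1) ^ j) (\<Sum>\<pi>\<in>?S (r + s). scale (of_int (sign \<pi>)) (w j (permute_list \<pi> xs))) =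
        scale ((-1) ^ (j * Suc r)) (standard_poly scale (r + s) xs)"
      by (simp add: \<kappa>(2) power_add mult.commute)
  qed
  finally show ?thesis by (simp add: scale_sum_left)
qed

end

section \<open>Evaluation of the brackets by parity\<close>

theorem proposition4p2p1:
  fixes scale :: "complex \<Rightarrow> 'a::{ring, monoid_mult} \<Rightarrow> 'a"
    and k k' :: nat
  assumes "complex_unital_algebra scale"
  shows "gerstenhaber_bracket scale (2 * k) (2 * k')
           (standard_poly scale (2 * k)) (standard_poly scale (2 * k')) = (\<lambda>xs. 0) \<and>
         gerstenhaber_bracket scale (2 * k) (2 * k' + 1)
           (standard_poly scale (2 * k)) (standard_poly scale (2 * k' + 1)) =
           (\<lambda>xs. scale (2 * of_nat k - 1) (standard_poly scale (2 * k + 2 * k') xs)) \<and>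
         gerstenhaber_bracket scale (2 * k + 1) (2 * k' + 1)
           (standard_poly scale (2 * k + 1)) (standard_poly scale (2 * k' + 1)) =
           (\<lambda>xs. scale (2 * (of_nat k - of_nat k')) (standard_poly scale (2 * k + 2 * k' + 1) xs))"
proof -
  interpret complex_unital_algebra scale by fact
  \<comment> \<open>For odd r every exponent is even, so all s + 1 terms are 1; for even r the terms
    alternate, starting with 1.\<close>
  have odd_block: "(\<Sum>j\<le>s. (-1 :: complex) ^ (j * Suc r)) = of_nat (Suc s)" if "odd r" for r s :: nat
    using that by simp
  have even_block: "(\<Sum>j\<le>s. (-1 :: complex) ^ (j * Suc r)) = (if even s then 1 else 0)"
    if "even r" for r s :: nat
    using that by (induction s) (auto simp: uminus_power_if)
  \<comment> \<open>The outer arity is m = s + 1, so even s means odd m. For m = 0 the coefficient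
    is 0 for either parity of n, in agreement with the empty sum.\<close>
  have summand: "(if m = 0 then 0 else unshuffle_sum scale n (m - 1) (standard_poly scale m) (standard_poly scale n) xs) =
      scale (if odd n then of_nat m else if odd m then 1 else 0) (standard_poly scale (m + n - 1) xs)"
    if len: "length xs + 1 = m + n" for m n xs
  proof (cases m)
    case (Suc s)
    then have "length xs = n + s" using len by simp
    from unshuffle_sum_standard_poly[OF this] show ?thesis
      using Suc odd_block[of n s] even_block[of n s] by (auto simp: add.commute)
  qed simp
  \<comment> \<open>The second term is the first with m and n exchanged.\<close>
  have bracket: "gerstenhaber_bracket scale m n (standard_poly scale m) (standard_poly scale n) xs =
      scale ((-1) powi ((int m - 1) * (int n - 1)) * (if odd n then of_nat m else if odd m then 1 else 0)
        - (if odd m then of_nat n else if odd n then 1 else 0)) (standard_poly scale (m + n - 1) xs)"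
    if "length xs + 1 = m + n" for m n xs
    using summand[OF that] summand[of xs n m] that
    by (simp add: gerstenhaber_bracket_def add.commute scale_left_diff_distrib)
  have bracket0: "gerstenhaber_bracket scale m n (standard_poly scale m) (standard_poly scale n) xs = 0"
    if "length xs + 1 \<noteq> m + n" for m n xs
    using that by (simp add: gerstenhaber_bracket_def)
  \<comment> \<open>An odd arity makes one factor of the exponent even. If both arities are even,
    the sign multiplies a coefficient 0.\<close>
  have pow: "(-1 :: complex) powi ((int m - 1) * (int n - 1)) = 1" if "odd m \<or> odd n" for m n
    using that by (simp add: power_int_minus_left)
  show ?thesis
  proof (intro conjI ext)
    fix xs
    show "gerstenhaber_bracket scale (2 * k) (2 * k')
        (standard_poly scale (2 * k)) (standard_poly scale (2 * k')) xs = 0"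
      \<comment> \<open>Both coefficients vanish for even arities; lists of any other length, hence
        all lists when k = k' = 0, give the default value 0.\<close>
      using bracket[of xs "2 * k" "2 * k'"] bracket0[of xs "2 * k" "2 * k'"] by fastforce
    show "gerstenhaber_bracket scale (2 * k) (2 * k' + 1)
        (standard_poly scale (2 * k)) (standard_poly scale (2 * k' + 1)) xs =
        scale (2 * of_nat k - 1) (standard_poly scale (2 * k + 2 * k') xs)"
    proof (cases "length xs = 2 * k + 2 * k'")
      case True
      \<comment> \<open>The first term contributes m = 2 k and the second contributes 1.\<close>
      then show ?thesis using bracket[of xs "2 * k" "2 * k' + 1"] pow[of "2 * k" "2 * k' + 1"] by simp
    next
      case False
      then show ?thesis using bracket0[of xs "2 * k" "2 * k' + 1"] by (simp add: standard_poly_def)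
    qed
    show "gerstenhaber_bracket scale (2 * k + 1) (2 * k' + 1)
        (standard_poly scale (2 * k + 1)) (standard_poly scale (2 * k' + 1)) xs =
        scale (2 * (of_nat k - of_nat k')) (standard_poly scale (2 * k + 2 * k' + 1) xs)"
    proof (cases "length xs = 2 * k + 2 * k' + 1")
      case True
      \<comment> \<open>Both inner arities are odd, so the coefficient is the difference m - n of
        the arities.\<close>
      then show ?thesis
        using bracket[of xs "2 * k + 1" "2 * k' + 1"] pow[of "2 * k + 1" "2 * k' + 1"]
        by (simp add: algebra_simps)
    next
      case False
      then show ?thesis
        using bracket0[of xs "2 * k + 1" "2 * k' + 1"] by (simp add: standard_poly_def)
    qed
  qed
qed

end
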